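(* Let $\mathcal{G}\subseteq\mathcal{P}_n$ be the gauge group of a subsystem code on $n$ qubits, let $\mathcal{K}\subseteq\mathcal{G}$ be a finite set of hermitian Pauli operators generating $\mathcal{G}$ up to overall phase factors (i.e. $\langle iI,\mathcal{G}\rangle=\langle iI,\mathcal{K}\rangle$), and let $S$ be a hermitian element of the stabilizer group of $\mathcal{G}$, i.e. $S\in\langle iI,\mathcal{G}\rangle\cap\mathcal{C}(\mathcal{G})$ with $S^\dagger=S$. Then the eigenvalue measurement of $S$ can be simulated by an adaptive sequence of eigenvalue measurements of operators from $\mathcal{K}$ if and only if there exist an integer $m\ge 0$ and operators $K_1,\ldots,K_m\in\mathcal{K}$ (repetitions allowed) such that $$S=\pm K_m\cdots K_2K_1$$ and $$[K_j,\;K_{j-1}\cdots K_1]=0\qquad\text{for all } j=2,\ldots,m .$$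
   Context: $\mathcal{P}_n=\langle iI,X_1,Z_1,\ldots,X_n,Z_n\rangle$ is the Pauli group on $n$ qubits, acting on $(\mathbb{C}^2)^{\otimes n}$. For $\mathcal{G}\subseteq\mathcal{P}_n$, $\mathcal{C}(\mathcal{G})$ is the centralizer of $\mathcal{G}$ in $\mathcal{P}_n$. A subsystem code is specified by its gauge group, a subgroup $\mathcal{G}\subseteq\mathcal{P}_n$; its stabilizer group is, up to overall phase factors, $\mathcal{G}\cap\mathcal{C}(\mathcal{G})$. The empty product is $I$. Adaptive protocol: an adaptive protocol of length $m$ measuring operators from $\mathcal{K}$ performs $m$ eigenvalue measurements in sequence. The operator $K_{j+1}\in\mathcal{K}$ measured at step $j+1$ may be chosen as an arbitrary function of the previous outcomes $\gamma_1,\ldots,\gamma_j\in\{+1,-1\}$ and possibly of some extra random bits. For a configuration of outcomes $\gamma=(\gamma_1,\ldots,\gamma_m)\in\{+1,-1\}^m$ (and fixed values of the random bits, if any), let $\Pi_j=\frac12(I+\gamma_jK_j)$ be the projector describing the measurement of $K_j$ with outcome $\gamma_j$, and let $R_m=\Pi_m\cdots\Pi_1$. Simulation: the protocol simulates the eigenvalue measurement of $S$ if there exists a function $\sigma:\{+1,-1\}^m\to\{+1,-1\}$ such that $$S R_m=R_m S=\sigma(\gamma)\,R_m\qquad\text{for all }\gamma\in\{+1,-1\}^m$$ (and all values of the random bits, if any). *)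

theory Defs
  imports "HOL-Analysis.Analysis" "HOL-Algebra.Elementary_Groups"
begin

text \<open>
  The qubits are the elements of a finite type \<open>'n\<close>, so the number of qubits is \<open>CARD('n)\<close>.
  An operator on the tensor product of \<open>CARD('n)\<close> copies of the complex plane is given by its
  matrix in the computational basis, whose members are labelled by the bit strings \<open>'n \<Rightarrow> bool\<close>.
\<close>

type_synonym 'n qop = "((complex, 'n \<Rightarrow> bool) vec, 'n \<Rightarrow> bool) vec"

definition tensor :: "('n::finite \<Rightarrow> complex ^ bool ^ bool) \<Rightarrow> 'n qop" where
  "tensor A = (\<chi> b c. \<Prod>q\<in>UNIV. A q $ b q $ c q)"

definition sigma_X :: "complex ^ bool ^ bool" where
  "sigma_X = (\<chi> b c. if b = c then 0 else 1)"

definition sigma_Z :: "complex ^ bool ^ bool" where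
  "sigma_Z = (\<chi> b c. if b = c then (if b then - 1 else 1) else 0)"

definition pauli_X :: "'n::finite \<Rightarrow> 'n qop" where
  "pauli_X q = tensor ((\<lambda>_. mat 1)(q := sigma_X))"

definition pauli_Z :: "'n::finite \<Rightarrow> 'n qop" where
  "pauli_Z q = tensor ((\<lambda>_. mat 1)(q := sigma_Z))"

definition qop_monoid :: "'n::finite qop monoid" where
  "qop_monoid = \<lparr>carrier = UNIV, monoid.mult = (**), one = mat 1\<rparr>"

text \<open>\<open>mat \<i>\<close> is the scalar matrix \<open>\<i> I\<close>.\<close>

definition pauli_group :: "'n::finite qop monoid" where
  "pauli_group = subgroup_generated (units_of qop_monoid)
     (insert (mat \<i>) (range pauli_X \<union> range pauli_Z))"

definition pauli_centralizer :: "'n::finite qop set \<Rightarrow> 'n qop set" where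
  "pauli_centralizer G = {P \<in> carrier pauli_group. \<forall>g\<in>G. P ** g = g ** P}"

definition dagger :: "'n::finite qop \<Rightarrow> 'n qop" where
  "dagger A = map_matrix cnj (transpose A)"

definition commutator :: "'n::finite qop \<Rightarrow> 'n qop \<Rightarrow> 'n qop" where
  "commutator A B = A ** B - B ** A"

text \<open>\<open>op_prod A m\<close> is \<open>A m \<cdots> A 2 A 1\<close>, with indices starting from 1.\<close>

primrec op_prod :: "(nat \<Rightarrow> 'n::finite qop) \<Rightarrow> nat \<Rightarrow> 'n qop" where
  "op_prod A 0 = mat 1"
| "op_prod A (Suc j) = A (Suc j) ** op_prod A j"

text \<open>The outcome \<open>\<gamma>\<^sub>j\<close> of step \<open>j\<close> (\<open>j = 1, \<dots>, m\<close>) is stored at list position \<open>j - 1\<close>.\<close>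

definition outcomes :: "nat \<Rightarrow> real list set" where
  "outcomes m = {\<gamma>. length \<gamma> = m \<and> set \<gamma> \<subseteq> {1, - 1}}"

text \<open>
  A protocol of length \<open>m\<close> using \<open>r\<close> random bits is a function \<open>f\<close>: if the random bits are \<open>\<omega>\<close> and
  the outcomes of the first \<open>j\<close> steps are \<open>\<gamma>\<close>, then \<open>f \<omega> \<gamma>\<close> is measured at step \<open>j + 1\<close>.
\<close>

definition adaptive_protocol ::
  "'n::finite qop set \<Rightarrow> nat \<Rightarrow> nat \<Rightarrow> (bool list \<Rightarrow> real list \<Rightarrow> 'n qop) \<Rightarrow> bool" where
  "adaptive_protocol K m r f \<longleftrightarrow>
     (\<forall>\<omega>. length \<omega> = r \<longrightarrow> (\<forall>j<m. \<forall>\<gamma>\<in>outcomes j. f \<omega> \<gamma> \<in> K))"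

definition meas_proj :: "'n::finite qop \<Rightarrow> real \<Rightarrow> 'n qop" where
  "meas_proj A s = (1/2) *\<^sub>R (mat 1 + s *\<^sub>R A)"

definition run_op ::
  "(bool list \<Rightarrow> real list \<Rightarrow> 'n::finite qop) \<Rightarrow> bool list \<Rightarrow> real list \<Rightarrow> 'n qop" where
  "run_op f \<omega> \<gamma> =
     op_prod (\<lambda>j. meas_proj (f \<omega> (take (j - 1) \<gamma>)) (\<gamma> ! (j - 1))) (length \<gamma>)"

definition simulates ::
  "nat \<Rightarrow> nat \<Rightarrow> (bool list \<Rightarrow> real list \<Rightarrow> 'n::finite qop) \<Rightarrow> 'n qop \<Rightarrow> bool" where
  "simulates m r f S \<longleftrightarrow>
     (\<exists>\<sigma> :: real list \<Rightarrow> real. (\<forall>\<gamma>\<in>outcomes m. \<sigma> \<gamma> \<in> {1, - 1}) \<and>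
        (\<forall>\<omega>. length \<omega> = r \<longrightarrow> (\<forall>\<gamma>\<in>outcomes m.
           S ** run_op f \<omega> \<gamma> = run_op f \<omega> \<gamma> ** S \<and>
           run_op f \<omega> \<gamma> ** S = \<sigma> \<gamma> *\<^sub>R run_op f \<omega> \<gamma>)))"

definition can_simulate :: "'n::finite qop set \<Rightarrow> 'n qop \<Rightarrow> bool" where
  "can_simulate K S \<longleftrightarrow> (\<exists>m r f. adaptive_protocol K m r f \<and> simulates m r f S)"

end

theory Submission
  imports Defs
begin

text \<open>
  If \<open>K\<^sub>j\<close> commutes with \<open>K\<^sub>j\<^sub>-\<^sub>1 \<cdots> K\<^sub>1\<close> for all \<open>j\<close>, then measuring \<open>K\<^sub>1, \<dots>, K\<^sub>m\<close> in this order
  measures the product \<open>K\<^sub>m \<cdots> K\<^sub>1\<close>, with outcome the product of the individual outcomes.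

  Conversely, let \<open>R\<close> be the operator of a run with \<open>R \<noteq> 0\<close>. Conjugating an operator by
  \<open>(I + \<gamma> K) / 2\<close> kills the Pauli operators anticommuting with \<open>K\<close> and sends a Pauli operator \<open>P\<close>
  commuting with \<open>K\<close> to \<open>(P + \<gamma> K P) / 2\<close>; hence \<open>R R\<^sup>\<dagger>\<close> is a real combination of products
  \<open>P = K\<^sub>i \<cdots> K\<^sub>1\<close> of the required form. As \<open>tr (S R R\<^sup>\<dagger>) = \<plusminus> tr (R R\<^sup>\<dagger>) \<noteq> 0\<close>, some such \<open>P\<close> has
  \<open>tr (S P) \<noteq> 0\<close>. A Pauli operator of nonzero trace is scalar, so \<open>S = \<plusminus> P\<close>.
\<close>

subsection \<open>Matrices\<close>

lemma matrix_mult_scaleR_right: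
  fixes A :: "'a::real_algebra_1 ^ 'n ^ 'm"
  shows "A ** (k *\<^sub>R B) = k *\<^sub>R (A ** B)"
  by (simp add: vec_eq_iff matrix_matrix_mult_def scaleR_sum_right)

lemma matrix_mult_scaleR_left:
  fixes A :: "'a::real_algebra_1 ^ 'n ^ 'm"
  shows "(k *\<^sub>R A) ** B = k *\<^sub>R (A ** B)"
  by (simp add: vec_eq_iff matrix_matrix_mult_def scaleR_sum_right)

lemma matrix_mult_minus_right:
  fixes A :: "'a::ring_1 ^ 'n ^ 'm"
  shows "A ** (- B) = - (A ** B)"
  by (simp add: vec_eq_iff matrix_matrix_mult_def sum_negf)

lemma matrix_mult_minus_left:
  fixes A :: "'a::ring_1 ^ 'n ^ 'm"
  shows "(- A) ** B = - (A ** B)"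
  by (simp add: vec_eq_iff matrix_matrix_mult_def sum_negf)

lemma matrix_mult_add_left:
  fixes A :: "'a::semiring_1 ^ 'n ^ 'm"
  shows "(A + B) ** C = A ** C + B ** C"
  by (simp add: vec_eq_iff matrix_matrix_mult_def sum.distrib distrib_right)

lemma matrix_mult_diff_right:
  fixes A :: "'a::ring_1 ^ 'n ^ 'm"
  shows "A ** (B - C) = A ** B - A ** C"
  by (simp add: vec_eq_iff matrix_matrix_mult_def sum_subtractf right_diff_distrib)

lemma matrix_mult_diff_left:
  fixes A :: "'a::ring_1 ^ 'n ^ 'm"
  shows "(A - B) ** C = A ** C - B ** C"
  by (simp add: vec_eq_iff matrix_matrix_mult_def sum_subtractf left_diff_distrib)

lemmas matrix_mult_linear =
  matrix_mult_scaleR_right matrix_mult_scaleR_left matrix_mult_minus_right matrix_mult_minus_left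
  matrix_add_ldistrib matrix_mult_add_left matrix_mult_diff_right matrix_mult_diff_left

lemma mat_mult_nth: "(mat k ** A) $ b $ c = k * (A $ b $ c)"
  for A :: "'a::semiring_1 ^ 'n ^ 'm"
  by (simp add: matrix_matrix_mult_def mat_def if_distrib[of "\<lambda>x. x * _"] cong: if_cong)

lemma mult_mat_nth: "(A ** mat k) $ b $ c = (A $ b $ c) * k"
  for A :: "'a::semiring_1 ^ 'n ^ 'm"
  by (simp add: matrix_matrix_mult_def mat_def if_distrib[of "\<lambda>x. _ * x"] cong: if_cong)

lemma mat_mult_commute: "mat k ** A = A ** mat k"
  for A :: "'a::comm_semiring_1 ^ 'n ^ 'n"
  by (simp add: vec_eq_iff mat_mult_nth mult_mat_nth mult.commute)

lemma mat_minus: "mat (- k) = - mat k"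
  for k :: "'a::ring_1"
  by (simp add: vec_eq_iff mat_def)

section \<open>Adjoint and trace\<close>

lemma dagger_mult: "dagger (A ** B) = dagger B ** dagger A"
  by (simp add: dagger_def vec_eq_iff map_matrix_def transpose_def matrix_matrix_mult_def mult.commute)

lemma dagger_add: "dagger (A + B) = dagger A + dagger B"
  by (simp add: dagger_def vec_eq_iff map_matrix_def transpose_def)

lemma dagger_minus: "dagger (- A) = - dagger A"
  by (simp add: dagger_def vec_eq_iff map_matrix_def transpose_def)

lemma dagger_scaleR: "dagger (k *\<^sub>R A) = k *\<^sub>R dagger A"
  by (simp add: dagger_def vec_eq_iff map_matrix_def transpose_def)

lemma dagger_mat: "dagger (mat k) = mat (cnj k)"
  by (auto simp add: dagger_def vec_eq_iff map_matrix_def transpose_def mat_def)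

text \<open>This is the squared Hilbert-Schmidt norm of \<open>A\<close>, so the trace can vanish
  only for the zero matrix.\<close>

lemma trace_mult_dagger:
  "trace (A ** dagger A) = (\<Sum>b\<in>UNIV. \<Sum>c\<in>UNIV. of_real ((cmod (A $ b $ c))\<^sup>2))"
  by (simp add: trace_def dagger_def map_matrix_def transpose_def matrix_matrix_mult_def
      complex_norm_square del: of_real_power)

lemma trace_mult_dagger_nonzero:
  assumes "A \<noteq> 0"
  shows "trace (A ** dagger A) \<noteq> 0"
proof
  assume "trace (A ** dagger A) = 0"
  then have "complex_of_real (\<Sum>b\<in>UNIV. \<Sum>c\<in>UNIV. (cmod (A $ b $ c))\<^sup>2) = 0"
    by (simp add: trace_mult_dagger)
  then have "(\<Sum>b\<in>UNIV. \<Sum>c\<in>UNIV. (cmod (A $ b $ c))\<^sup>2) = 0"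
    by (simp only: of_real_eq_0_iff)
  then have "A = 0"
    by (simp add: sum_nonneg_eq_0_iff sum_nonneg vec_eq_iff)
  with assms show False by simp
qed

text \<open>Conjugation by the involution \<open>g\<close> preserves the trace but turns
  \<open>A\<close> into \<open>- A\<close>.\<close>

lemma trace_anticommute_eq_0:
  fixes A g :: "complex ^ 'n ^ 'n"
  assumes "g ** g = mat 1" and "A ** g = - (g ** A)"
  shows "trace A = 0"
proof -
  have "trace A = trace (A ** (g ** g))"
    by (simp add: assms)
  also have "\<dots> = trace (g ** (A ** g))"
    by (metis matrix_mul_assoc trace_mul_sym)
  also have "\<dots> = trace (- ((g ** g) ** A))"
    by (simp add: assms(2) matrix_mult_linear matrix_mul_assoc)
  also have "\<dots> = - trace A"
    by (simp add: assms(1) trace_def sum_negf)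
  finally show ?thesis by simp
qed

subsection \<open>Pauli operators\<close>

lemma pauli_X_nth: "pauli_X q $ b $ c = (if c = b(q := \<not> b q) then 1 else 0)"
proof -
  \<comment> \<open>Each tensor factor contributes 0 or 1: the identity asks the bits at
    \<open>p\<close> to agree, \<open>sigma_X\<close> asks the bits at \<open>q\<close> to
    differ.\<close>
  have "pauli_X q $ b $ c = (\<Prod>p\<in>UNIV. if c p = (b(q := \<not> b q)) p then 1 else 0)"
    unfolding pauli_X_def tensor_def by (auto simp: sigma_X_def mat_def intro!: prod.cong)
  also have "\<dots> = (if c = b(q := \<not> b q) then 1 else 0)"
    by (auto simp add: fun_eq_iff)
  finally show ?thesis .
qed

lemma pauli_Z_nth: "pauli_Z q $ b $ c = (if c = b then if b q then - 1 else 1 else 0)"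
proof (cases "c = b")
  case True
  have "pauli_Z q $ b $ b = (\<Prod>p\<in>UNIV. if p = q then if b q then - 1 else 1 else 1)"
    unfolding pauli_Z_def tensor_def vec_lambda_beta
    by (rule prod.cong) (auto simp: sigma_Z_def mat_def)
  then show ?thesis
    using True by simp
next
  case False
  then obtain p where "b p \<noteq> c p" by fastforce
  then have "((\<lambda>_. mat 1)(q := sigma_Z)) p $ b p $ c p = 0"
    by (simp add: sigma_Z_def mat_def)
  then have "(\<Prod>p\<in>UNIV. ((\<lambda>_. mat 1)(q := sigma_Z)) p $ b p $ c p) = 0"
    by (intro prod_zero bexI[of _ p]) simp_all
  then show ?thesis
    using False unfolding pauli_Z_def tensor_def by simp
qed

lemma pauli_X_mult_nth: "(pauli_X q ** A) $ b $ c = A $ (b(q := \<not> b q)) $ c"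
  by (simp add: matrix_matrix_mult_def pauli_X_nth if_distrib[of "\<lambda>x. x * _"] cong: if_cong)

lemma mult_pauli_X_nth: "(A ** pauli_X q) $ b $ c = A $ b $ (c(q := \<not> c q))"
proof -
  have "c = d(q := \<not> d q) \<longleftrightarrow> d = c(q := \<not> c q)" for d
    by auto
  then show ?thesis
    by (simp add: matrix_matrix_mult_def pauli_X_nth if_distrib[of "\<lambda>x. _ * x"] cong: if_cong)
qed

lemma pauli_Z_mult_nth: "(pauli_Z q ** A) $ b $ c = (if b q then - 1 else 1) * A $ b $ c"
  by (simp add: matrix_matrix_mult_def pauli_Z_nth if_distrib[of "\<lambda>x. x * _"] cong: if_cong)

lemma mult_pauli_Z_nth: "(A ** pauli_Z q) $ b $ c = (if c q then - 1 else 1) * A $ b $ c"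
proof -
  have "(A ** pauli_Z q) $ b $ c =
      (\<Sum>d\<in>UNIV. if d = c then A $ b $ d * (if d q then - 1 else 1) else 0)"
    unfolding matrix_matrix_mult_def vec_lambda_beta
    by (rule sum.cong) (auto simp: pauli_Z_nth)
  then show ?thesis
    by simp
qed

lemma pauli_X_square: "pauli_X q ** pauli_X q = mat 1"
  by (auto simp add: vec_eq_iff pauli_X_mult_nth pauli_X_nth mat_def)

lemma pauli_Z_square: "pauli_Z q ** pauli_Z q = mat 1"
  by (auto simp add: vec_eq_iff pauli_Z_mult_nth pauli_Z_nth mat_def)

lemma dagger_pauli_X: "dagger (pauli_X q) = pauli_X q"
proof -
  have "b = c(q := \<not> c q) \<longleftrightarrow> c = b(q := \<not> b q)" for b c :: "'a \<Rightarrow> bool"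
    by auto
  then show ?thesis
    by (auto simp add: dagger_def vec_eq_iff map_matrix_def transpose_def pauli_X_nth)
qed

lemma dagger_pauli_Z: "dagger (pauli_Z q) = pauli_Z q"
  by (auto simp add: dagger_def vec_eq_iff map_matrix_def transpose_def pauli_Z_nth)

lemma pauli_mult_closed:
  "A \<in> carrier pauli_group \<Longrightarrow> B \<in> carrier pauli_group \<Longrightarrow> A ** B \<in> carrier pauli_group"
  using generate.eng[of A "units_of qop_monoid" _ B]
  by (simp add: pauli_group_def carrier_subgroup_generated units_of_def qop_monoid_def)

lemma pauli_one_closed: "mat 1 \<in> carrier pauli_group"
  using generate.one[of "units_of qop_monoid"]
  by (simp add: pauli_group_def carrier_subgroup_generated units_of_def qop_monoid_def)

text \<open>Inverses need no case of their own: \<open>X\<close> and \<open>Z\<close> are involutions and \<open>\<i>\<^sup>-\<^sup>1 = - \<i>\<close>.\<close>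

lemma pauli_induct [consumes 1, case_names one imag X Z minus mult]:
  assumes "A \<in> carrier pauli_group"
    and one: "P (mat 1)" and imag: "P (mat \<i>)"
    and X: "\<And>q. P (pauli_X q)" and Z: "\<And>q. P (pauli_Z q)"
    and minus: "\<And>A. P A \<Longrightarrow> P (- A)"
    and mult: "\<And>A B. P A \<Longrightarrow> P B \<Longrightarrow> P (A ** B)"
  shows "P A"
proof -
  interpret monoid "qop_monoid :: 'a qop monoid"
    by (rule monoidI) (auto simp: qop_monoid_def matrix_mul_assoc)
  interpret units: group "units_of (qop_monoid :: 'a qop monoid)"
    by (rule units_group)
  have inv_eq: "inv\<^bsub>units_of qop_monoid\<^esub> h = g"
    if "h \<in> carrier (units_of qop_monoid)" "h ** g = mat 1" "g ** h = mat 1" for g h :: "'a qop"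
  proof -
    have "g \<in> carrier (units_of qop_monoid)"
      using that by (auto simp: units_of_def Units_def qop_monoid_def)
    then show ?thesis
      using that by (intro units.inv_equality) (auto simp: units_of_def qop_monoid_def)
  qed
  \<comment> \<open>\<open>subgroup_generated\<close> intersects the generators with the carrier of
    the ambient group, here the invertible matrices.\<close>
  have "A \<in> generate (units_of qop_monoid)
      (carrier (units_of qop_monoid) \<inter> insert (mat \<i>) (range pauli_X \<union> range pauli_Z))"
    using assms(1) by (simp add: pauli_group_def carrier_subgroup_generated)
  then show ?thesis
  proof induction
    case one
    then show ?case using assms(2) by (simp add: units_of_def qop_monoid_def)
  next
    case (incl h)
    then show ?case using imag X Z by auto
  next
    case (inv h)
    then have h: "h \<in> carrier (units_of qop_monoid)" by blast
    from inv consider "h = mat \<i>" | q where "h = pauli_X q" | q where "h = pauli_Z q"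
      by auto
    then show ?case
    proof cases
      case 1
      have "mat \<i> ** - mat \<i> = (mat 1 :: 'a qop)" "- mat \<i> ** mat \<i> = (mat 1 :: 'a qop)"
        by (auto simp: matrix_mult_linear vec_eq_iff mat_mult_nth) (auto simp: mat_def)
      then have "inv\<^bsub>units_of qop_monoid\<^esub> h = - mat \<i>"
        using inv_eq[OF h] 1 by blast
      then show ?thesis using minus[OF imag] by simp
    next
      case 2
      then show ?thesis using inv_eq[OF h, of "pauli_X q"] X by (simp add: pauli_X_square)
    next
      case 3
      then show ?thesis using inv_eq[OF h, of "pauli_Z q"] Z by (simp add: pauli_Z_square)
    qed
  next
    case (eng h1 h2)
    then show ?case using mult by (simp add: units_of_def qop_monoid_def)
  qed
qed

lemma pauli_unitary:
  assumes "A \<in> carrier pauli_group"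
  shows "A ** dagger A = mat 1"
  using assms
proof (induction rule: pauli_induct)
  case one
  then show ?case by (simp add: dagger_mat)
next
  case imag
  then show ?case by (simp add: dagger_mat vec_eq_iff mat_mult_nth) (simp add: mat_def)
next
  case (X q)
  then show ?case by (simp add: dagger_pauli_X pauli_X_square)
next
  case (Z q)
  then show ?case by (simp add: dagger_pauli_Z pauli_Z_square)
next
  case (minus A)
  then show ?case by (simp add: dagger_minus matrix_mult_linear)
next
  case (mult A B)
  then have "A ** B ** (dagger B ** dagger A) = mat 1"
    by (metis matrix_mul_assoc matrix_mul_rid)
  then show ?case by (simp add: dagger_mult)
qed

section \<open>Commutation up to sign\<close>

definition commute_or_anticommute :: "'n::finite qop \<Rightarrow> 'n qop \<Rightarrow> bool" where
  "commute_or_anticommute A B \<longleftrightarrow> A ** B = B ** A \<or> A ** B = - (B ** A)"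

lemma commute_or_anticommute_sym:
  "commute_or_anticommute A B \<Longrightarrow> commute_or_anticommute B A"
  unfolding commute_or_anticommute_def by (metis minus_minus)

lemma commute_or_anticommute_mat: "commute_or_anticommute (mat k) B"
  by (simp add: commute_or_anticommute_def mat_mult_commute)

lemma commute_or_anticommute_minus:
  "commute_or_anticommute A B \<Longrightarrow> commute_or_anticommute (- A) B"
  by (auto simp: commute_or_anticommute_def matrix_mult_linear)

text \<open>\<open>C\<close> is moved past \<open>B\<close> and then past \<open>A\<close>, and the
  two signs multiply.\<close>

lemma commute_or_anticommute_mult:
  assumes "commute_or_anticommute A C" and "commute_or_anticommute B C"
  shows "commute_or_anticommute (A ** B) C"
proof -
  have "A ** B ** C = A ** (B ** C)"
    by (simp add: matrix_mul_assoc)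
  also have "\<dots> = A ** C ** B \<or> \<dots> = - (A ** C ** B)"
    using assms(2)
    by (auto simp: commute_or_anticommute_def matrix_mult_linear matrix_mul_assoc[symmetric])
  finally show ?thesis
    using assms(1)
    by (auto simp: commute_or_anticommute_def matrix_mult_linear matrix_mul_assoc)
qed

text \<open>The relation survives negation and products in its first argument and always holds for
  scalars, so the generators decide it. \<open>B\<close> may be any matrix here.\<close>

lemma pauli_commute_or_anticommute_aux:
  assumes "A \<in> carrier pauli_group"
    and "\<And>q. commute_or_anticommute (pauli_X q) B" and "\<And>q. commute_or_anticommute (pauli_Z q) B"
  shows "commute_or_anticommute A B"
  using assms(1)
  by (induction rule: pauli_induct)
    (simp_all add: assms commute_or_anticommute_mat commute_or_anticommute_minus
      commute_or_anticommute_mult)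

lemma pauli_X_commute: "pauli_X p ** pauli_X q = pauli_X q ** pauli_X p"
  by (cases "p = q") (simp_all add: vec_eq_iff pauli_X_mult_nth pauli_X_nth fun_upd_twist)

lemma pauli_Z_commute: "pauli_Z p ** pauli_Z q = pauli_Z q ** pauli_Z p"
  by (simp add: vec_eq_iff pauli_Z_mult_nth pauli_Z_nth)

lemma pauli_X_pauli_Z:
  "pauli_X p ** pauli_Z q = (if p = q then - (pauli_Z q ** pauli_X p) else pauli_Z q ** pauli_X p)"
  by (auto simp add: vec_eq_iff mult_pauli_Z_nth pauli_Z_mult_nth pauli_X_nth)

lemma pauli_commute_or_anticommute:
  assumes "A \<in> carrier pauli_group" and "B \<in> carrier pauli_group"
  shows "commute_or_anticommute A B"
proof -
  have XZ: "commute_or_anticommute (pauli_X p) (pauli_Z q)" for p q :: 'a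
    by (simp add: commute_or_anticommute_def pauli_X_pauli_Z)
  have XX: "commute_or_anticommute (pauli_X p) (pauli_X q)" for p q :: 'a
    by (simp add: commute_or_anticommute_def pauli_X_commute)
  have ZZ: "commute_or_anticommute (pauli_Z p) (pauli_Z q)" for p q :: 'a
    by (simp add: commute_or_anticommute_def pauli_Z_commute)
  show ?thesis
    \<comment> \<open>The reduction to generators is applied once per argument, with symmetry in
      between: first \<open>B\<close> against each generator, then \<open>A\<close> against
      \<open>B\<close>.\<close>
    using assms XX XZ ZZ
    by (metis commute_or_anticommute_sym pauli_commute_or_anticommute_aux)
qed

section \<open>Operators commuting with all Pauli operators\<close>

lemma flip_invariant_imp_constant:
  fixes f :: "('n::finite \<Rightarrow> bool) \<Rightarrow> 'a"
  assumes flip: "\<And>b q. f (b(q := \<not> b q)) = f b"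
  shows "f b = f c"
proof -
  have upd: "f (b(q := x)) = f b" for b q x
    using flip[of b q] by (cases "x = b q") auto
  \<comment> \<open>The string \<open>b\<close> is turned into \<open>c\<close> one bit at a time;
    \<open>Q\<close> collects the positions already overwritten.\<close>
  have "f (\<lambda>p. if p \<in> Q then c p else b p) = f b" if "finite Q" for Q
    using that
  proof induction
    case (insert q Q)
    have "(\<lambda>p. if p \<in> insert q Q then c p else b p) = (\<lambda>p. if p \<in> Q then c p else b p)(q := c q)"
      by (auto simp: fun_eq_iff)
    then show ?case using upd insert.IH by simp
  qed simp
  from this[of UNIV] show ?thesis by simp
qed

text \<open>Commuting with every \<open>pauli_Z q\<close> kills the off-diagonal entries, since at a
  bit where row and column differ the two sides have opposite signs. Commuting with every
  \<open>pauli_X q\<close> makes the diagonal invariant under bit flips, hence constant.\<close>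

lemma commute_pauli_imp_scalar:
  assumes X: "\<And>q. A ** pauli_X q = pauli_X q ** A"
    and Z: "\<And>q. A ** pauli_Z q = pauli_Z q ** A"
  obtains k where "A = mat k"
proof -
  have off: "A $ b $ c = 0" if "b \<noteq> c" for b c
  proof -
    obtain q where q: "b q \<noteq> c q" using \<open>b \<noteq> c\<close> by fastforce
    have "(A ** pauli_Z q) $ b $ c = (pauli_Z q ** A) $ b $ c"
      by (simp add: Z)
    then show ?thesis
      using q by (cases "b q") (auto simp: mult_pauli_Z_nth pauli_Z_mult_nth)
  qed
  have diag: "A $ b $ b = A $ c $ c" for b c
  proof (rule flip_invariant_imp_constant[where f = "\<lambda>b. A $ b $ b"])
    fix b q
    \<comment> \<open>At this off-diagonal position, both sides of the commutation relation reduce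
      to diagonal entries of \<open>A\<close>, one for each of the two strings.\<close>
    have "(A ** pauli_X q) $ (b(q := \<not> b q)) $ b = (pauli_X q ** A) $ (b(q := \<not> b q)) $ b"
      by (simp add: X)
    then show "A $ (b(q := \<not> b q)) $ (b(q := \<not> b q)) = A $ b $ b"
      by (simp add: mult_pauli_X_nth pauli_X_mult_nth)
  qed
  \<comment> \<open>\<open>undefined\<close> serves as an arbitrary bit string; all diagonal entries
    agree.\<close>
  have "A = mat (A $ undefined $ undefined)"
    using off diag by (auto simp: vec_eq_iff mat_def)
  then show ?thesis by (rule that)
qed

lemma pauli_trace_nonzero_imp_scalar:
  assumes "A \<in> carrier pauli_group" and "trace A \<noteq> 0"
  obtains k where "A = mat k"
proof -
  \<comment> \<open>Anticommuting with an involution would force trace zero, so only commutation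
    remains.\<close>
  have aux: "A ** g = g ** A" if "g ** g = mat 1" "commute_or_anticommute A g" for g
    using that assms(2) trace_anticommute_eq_0 unfolding commute_or_anticommute_def by blast
  have "commute_or_anticommute A (pauli_X q)" "commute_or_anticommute A (pauli_Z q)" for q
    by (rule pauli_commute_or_anticommute_aux[OF assms(1)];
        simp add: commute_or_anticommute_def pauli_X_commute pauli_Z_commute pauli_X_pauli_Z)+
  then show ?thesis
    using commute_pauli_imp_scalar that aux pauli_X_square pauli_Z_square by metis
qed

lemma pauli_hermitian_involution:
  "A \<in> carrier pauli_group \<Longrightarrow> dagger A = A \<Longrightarrow> A ** A = mat 1"
  using pauli_unitary by metis

subsection \<open>Products of commuting factors\<close>

text \<open>These are the products \<open>K\<^sub>m \<cdots> K\<^sub>1\<close> of the theorem, freed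
  from indices. The commutation condition for the first factor is automatic, as it is multiplied
  onto the identity.\<close>

inductive_set commuting_products :: "'n::finite qop set \<Rightarrow> 'n qop set" for K where
  one: "mat 1 \<in> commuting_products K"
| mult: "P \<in> commuting_products K \<Longrightarrow> A \<in> K \<Longrightarrow> A ** P = P ** A \<Longrightarrow> A ** P \<in> commuting_products K"

lemma op_prod_cong:
  "(\<And>j. j \<in> {1..m} \<Longrightarrow> A j = B j) \<Longrightarrow> op_prod A m = op_prod B m"
  by (induction m) auto

lemma commuting_products_imp_op_prod:
  assumes "P \<in> commuting_products K"
  shows "\<exists>m Ks. (\<forall>j\<in>{1..m}. Ks j \<in> K) \<and> P = op_prod Ks m \<and>
    (\<forall>j\<in>{2..m}. commutator (Ks j) (op_prod Ks (j - 1)) = 0)"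
  using assms
proof induction
  case one
  show ?case by (rule exI[of _ 0]) simp
next
  case (mult P A)
  then obtain m Ks where IH: "\<forall>j\<in>{1..m}. Ks j \<in> K" "P = op_prod Ks m"
    "\<forall>j\<in>{2..m}. commutator (Ks j) (op_prod Ks (j - 1)) = 0"
    by blast
  \<comment> \<open>The new factor takes the first position that \<open>op_prod Ks m\<close> does
    not read, so the earlier partial products stay the same.\<close>
  define Ks' where "Ks' = Ks(Suc m := A)"
  have eq: "op_prod Ks' j = op_prod Ks j" if "j \<le> m" for j
    using that by (intro op_prod_cong) (auto simp: Ks'_def)
  have "commutator (Ks' j) (op_prod Ks' (j - 1)) = 0" if "j \<in> {2..Suc m}" for j
  proof (cases "j = Suc m")
    case True
    then show ?thesis
      using eq IH(2) mult.hyps(3) by (simp add: Ks'_def commutator_def)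
  next
    case False
    then have "j \<in> {2..m}" using that by auto
    then show ?thesis
      using IH(3) eq[of "j - 1"] by (auto simp: Ks'_def)
  qed
  moreover have "\<forall>j\<in>{1..Suc m}. Ks' j \<in> K"
    using IH(1) mult.hyps(2) by (auto simp: Ks'_def)
  moreover have "A ** P = op_prod Ks' (Suc m)"
    using eq IH(2) by (simp add: Ks'_def)
  ultimately show ?case by blast
qed

lemma commuting_products_pauli:
  assumes "K \<subseteq> carrier pauli_group" and "P \<in> commuting_products K"
  shows "P \<in> carrier pauli_group"
  using assms(2,1) by induction (auto intro: pauli_mult_closed pauli_one_closed)

text \<open>Since \<open>A\<close> commutes with \<open>P\<close>, the square of
  \<open>A ** P\<close> is the product of the squares of \<open>A\<close> and
  \<open>P\<close>.\<close>

lemma commuting_products_involution: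
  assumes "\<And>A. A \<in> K \<Longrightarrow> A ** A = mat 1" and "P \<in> commuting_products K"
  shows "P ** P = mat 1"
  using assms(2)
proof induction
  case (mult P A)
  have "A ** P ** (A ** P) = A ** (P ** A) ** P"
    by (simp add: matrix_mul_assoc)
  also have "\<dots> = (A ** A) ** (P ** P)"
    by (simp add: mult.hyps(3)[symmetric] matrix_mul_assoc)
  finally show ?case
    using mult assms(1) by simp
qed simp

subsection \<open>Runs of measurements\<close>

lemma run_op_Nil: "run_op f \<omega> [] = mat 1"
  by (simp add: run_op_def)

text \<open>Earlier steps read only entries of \<open>\<gamma>\<close>, so the appended outcome
  enters through the last projector alone.\<close>

lemma run_op_snoc: "run_op f \<omega> (\<gamma> @ [s]) = meas_proj (f \<omega> \<gamma>) s ** run_op f \<omega> \<gamma>"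
  unfolding run_op_def
  by (simp add: nth_append)
    (intro arg_cong2[where f = "(**)"] refl op_prod_cong, auto simp: nth_append)

lemma outcomes_0: "outcomes 0 = {[]}"
  by (auto simp: outcomes_def)

lemma outcomes_Suc: "outcomes (Suc j) = {\<gamma> @ [s] | \<gamma> s. \<gamma> \<in> outcomes j \<and> s \<in> {1, - 1}}"
proof (intro Set.set_eqI iffI)
  fix \<gamma> assume \<gamma>: "\<gamma> \<in> outcomes (Suc j)"
  then have "\<gamma> = butlast \<gamma> @ [last \<gamma>]" "last \<gamma> \<in> set \<gamma>"
    by (auto simp: outcomes_def intro!: append_butlast_last_id[symmetric] last_in_set)
  moreover have "butlast \<gamma> \<in> outcomes j"
    using \<gamma> by (auto simp: outcomes_def dest: in_set_butlastD)
  moreover have "set \<gamma> \<subseteq> {1, - 1}"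
    using \<gamma> by (simp add: outcomes_def)
  ultimately show "\<gamma> \<in> {\<gamma> @ [s] | \<gamma> s. \<gamma> \<in> outcomes j \<and> s \<in> {1, - 1}}"
    by blast
qed (auto simp: outcomes_def)

section \<open>Measurement projectors and nonzero runs\<close>

lemma meas_proj_sum: "meas_proj A 1 + meas_proj A (- 1) = mat 1"
proof -
  have "meas_proj A 1 + meas_proj A (- 1) = (1 / 2) *\<^sub>R (mat 1 + mat 1)"
    by (simp add: meas_proj_def scaleR_right_distrib[symmetric] del: scaleR_half_double)
  then show ?thesis by simp
qed

text \<open>The two projectors of a measurement add up to the identity, so a run operator is the sum
  of its two continuations; if it is nonzero, one of them is.\<close>

lemma exists_nonzero_run: "\<exists>\<gamma>\<in>outcomes j. run_op f \<omega> \<gamma> \<noteq> 0"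
proof (induction j)
  case 0
  have "(mat 1 :: 'a qop) \<noteq> 0" by (auto simp: vec_eq_iff mat_def)
  then show ?case by (simp add: outcomes_0 run_op_Nil)
next
  case (Suc j)
  then obtain \<gamma> where \<gamma>: "\<gamma> \<in> outcomes j" "run_op f \<omega> \<gamma> \<noteq> 0" by blast
  have "run_op f \<omega> (\<gamma> @ [1]) + run_op f \<omega> (\<gamma> @ [- 1]) = run_op f \<omega> \<gamma>"
    by (simp add: run_op_snoc matrix_mult_add_left[symmetric] meas_proj_sum)
  then have "run_op f \<omega> (\<gamma> @ [1]) \<noteq> 0 \<or> run_op f \<omega> (\<gamma> @ [- 1]) \<noteq> 0"
    using \<gamma>(2) by auto
  then show ?case
    using \<gamma>(1) unfolding outcomes_Suc by blast
qed

lemma meas_proj_eigen: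
  assumes "A ** A = mat 1" and "s \<in> {1, - 1}"
  shows "A ** meas_proj A s = s *\<^sub>R meas_proj A s"
  using assms by (auto simp: meas_proj_def matrix_mult_linear algebra_simps)

lemma meas_proj_commute:
  "A ** B = B ** A \<Longrightarrow> meas_proj A s ** B = B ** meas_proj A s"
  by (simp add: meas_proj_def matrix_mult_linear)

lemma meas_proj_idem:
  assumes "A ** A = mat 1" and "s \<in> {1, - 1}"
  shows "meas_proj A s ** meas_proj A s = meas_proj A s"
proof -
  have "meas_proj A s ** meas_proj A s = (1 / 2) *\<^sub>R (meas_proj A s + s *\<^sub>R (A ** meas_proj A s))"
    unfolding meas_proj_def[of A s] by (simp add: matrix_mult_linear)
  also have "\<dots> = (1 / 2) *\<^sub>R (meas_proj A s + meas_proj A s)"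
    using assms by (auto simp: meas_proj_eigen)
  finally show ?thesis by simp
qed

text \<open>Moving \<open>P\<close> across the projector flips the outcome, and the projectors for
  opposite outcomes are orthogonal.\<close>

lemma meas_proj_conj_anticommute:
  assumes "A ** A = mat 1" and "s \<in> {1, - 1}" and "A ** P = - (P ** A)"
  shows "meas_proj A s ** P ** meas_proj A s = 0"
proof -
  have "meas_proj A s ** P = P ** meas_proj A (- s)"
    by (simp add: meas_proj_def matrix_mult_linear assms(3))
  moreover have "meas_proj A (- s) ** meas_proj A s
      = (1 / 2) *\<^sub>R (meas_proj A s - s *\<^sub>R (A ** meas_proj A s))"
    unfolding meas_proj_def[of A "- s"] by (simp add: matrix_mult_linear)
  then have "meas_proj A (- s) ** meas_proj A s = 0"
    using assms by (auto simp: meas_proj_eigen)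
  ultimately show ?thesis
    by (simp add: matrix_mul_assoc[symmetric])
qed

text \<open>By linearity only a single product \<open>P\<close> matters. Extending \<open>P\<close>
  by \<open>A\<close> is allowed when the two commute; when they do not, the projector annihilates
  the term, so no forbidden product ever arises.\<close>

lemma meas_proj_conj_span:
  assumes inv: "A ** A = mat 1" and s: "s \<in> {1, - 1}" and "A \<in> K"
    and ca: "\<And>P. P \<in> commuting_products K \<Longrightarrow> commute_or_anticommute A P"
    and "Q \<in> span (commuting_products K)"
  shows "meas_proj A s ** Q ** meas_proj A s \<in> span (commuting_products K)"
  using assms(5)
proof (induction rule: span_induct_alt)
  case base
  then show ?case by (simp add: span_zero)
next
  case (step k P Q)
  have "meas_proj A s ** P ** meas_proj A s \<in> span (commuting_products K)"
  proof (cases "A ** P = P ** A")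
    case True
    then have "meas_proj A s ** P = P ** meas_proj A s"
      by (rule meas_proj_commute)
    then have "meas_proj A s ** P ** meas_proj A s = meas_proj A s ** P"
      using meas_proj_idem[OF inv s] by (metis matrix_mul_assoc)
    also have "\<dots> = (1 / 2) *\<^sub>R (P + s *\<^sub>R (A ** P))"
      by (simp add: meas_proj_def matrix_mult_linear)
    finally show ?thesis
      using commuting_products.mult[OF step(1) \<open>A \<in> K\<close> True] step(1)
      by (simp add: span_add span_base span_scale)
  next
    case False
    then have "A ** P = - (P ** A)"
      using ca step unfolding commute_or_anticommute_def by blast
    then show ?thesis
      using meas_proj_conj_anticommute[OF inv s] by (simp add: span_zero)
  qed
  then show ?case
    using step by (simp add: matrix_mult_linear span_add span_scale)
qed

text \<open>Each further measurement conjugates the previous \<open>R ** dagger R\<close> by a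
  self-adjoint projector. The bound \<open>j \<le> m\<close> keeps every history consulted shorter
  than \<open>m\<close>, where \<open>f\<close> is known to choose from \<open>K\<close>.\<close>

lemma run_op_dagger_in_span:
  assumes K: "K \<subseteq> carrier pauli_group" and herm: "\<And>A. A \<in> K \<Longrightarrow> dagger A = A"
    and f: "\<And>j \<gamma>. j < m \<Longrightarrow> \<gamma> \<in> outcomes j \<Longrightarrow> f \<omega> \<gamma> \<in> K"
    and "j \<le> m" and "\<gamma> \<in> outcomes j"
  shows "run_op f \<omega> \<gamma> ** dagger (run_op f \<omega> \<gamma>) \<in> span (commuting_products K)"
  using assms(4,5)
proof (induction j arbitrary: \<gamma>)
  case 0
  then show ?case
    by (auto simp: outcomes_0 run_op_Nil dagger_mat intro!: span_base commuting_products.one)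
next
  case (Suc j)
  then obtain \<delta> s where \<gamma>: "\<gamma> = \<delta> @ [s]" "\<delta> \<in> outcomes j" "s \<in> {1, - 1}"
    by (auto simp: outcomes_Suc)
  let ?A = "f \<omega> \<delta>" and ?R = "run_op f \<omega> \<delta>"
  have A: "?A \<in> K" using f[of j \<delta>] Suc.prems \<gamma> by simp
  have "dagger (meas_proj ?A s) = meas_proj ?A s"
    using herm[OF A] by (simp add: meas_proj_def dagger_scaleR dagger_add dagger_mat)
  then have "run_op f \<omega> \<gamma> ** dagger (run_op f \<omega> \<gamma>)
      = meas_proj ?A s ** (?R ** dagger ?R) ** meas_proj ?A s"
    by (simp add: \<gamma>(1) run_op_snoc dagger_mult matrix_mul_assoc)
  moreover have "?A ** ?A = mat 1"
    using A K herm by (auto intro: pauli_hermitian_involution)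
  moreover have "commute_or_anticommute ?A P" if "P \<in> commuting_products K" for P
    using A K commuting_products_pauli[OF K that] by (auto intro: pauli_commute_or_anticommute)
  ultimately show ?case
    using meas_proj_conj_span[of ?A s K "?R ** dagger ?R"] Suc \<gamma> A by auto
qed

section \<open>From a product to a simulating protocol\<close>

lemma op_prod_commute:
  "(\<And>j. j \<in> {1..m} \<Longrightarrow> S ** B j = B j ** S) \<Longrightarrow> S ** op_prod B m = op_prod B m ** S"
proof (induction m)
  case (Suc m)
  have "S ** op_prod B (Suc m) = B (Suc m) ** (S ** op_prod B m)"
    using Suc.prems[of "Suc m"] by (simp add: matrix_mul_assoc)
  also have "\<dots> = op_prod B (Suc m) ** S"
    using Suc by (simp add: matrix_mul_assoc)
  finally show ?case .
qed simp

text \<open>The newest operator commutes past the earlier product to reach its own projector, where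
  it becomes its outcome. The projector then moves to the front and leaves the shorter product to
  the induction hypothesis.\<close>

lemma op_prod_meas_proj:
  assumes "\<And>j. j \<in> {1..m} \<Longrightarrow> A j ** A j = mat 1"
    and "\<And>j. j \<in> {1..m} \<Longrightarrow> c j \<in> {1, - 1}"
    and "\<And>j. j \<in> {2..m} \<Longrightarrow> A j ** op_prod A (j - 1) = op_prod A (j - 1) ** A j"
  shows "op_prod A m ** op_prod (\<lambda>j. meas_proj (A j) (c j)) m
    = (\<Prod>j=1..m. c j) *\<^sub>R op_prod (\<lambda>j. meas_proj (A j) (c j)) m"
  using assms
proof (induction m)
  case (Suc m)
  let ?P = "op_prod A m" and ?R = "op_prod (\<lambda>j. meas_proj (A j) (c j)) m"
  let ?A = "A (Suc m)" and ?M = "meas_proj (A (Suc m)) (c (Suc m))"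
  \<comment> \<open>The hypothesis starts at index 2; for \<open>m = 0\<close> the earlier product
    is the identity.\<close>
  have comm: "?A ** ?P = ?P ** ?A"
    using Suc.prems(3)[of "Suc m"] by (cases m) auto
  have "?A ** ?P ** (?M ** ?R) = ?P ** (?A ** ?M) ** ?R"
    by (simp add: comm matrix_mul_assoc)
  also have "\<dots> = c (Suc m) *\<^sub>R (?P ** ?M ** ?R)"
    using Suc.prems(1,2)[of "Suc m"] by (simp add: meas_proj_eigen matrix_mult_linear)
  also have "\<dots> = c (Suc m) *\<^sub>R (?M ** (?P ** ?R))"
    by (simp add: meas_proj_commute[OF comm, symmetric] matrix_mul_assoc)
  also have "\<dots> = c (Suc m) *\<^sub>R (?M ** ((\<Prod>j=1..m. c j) *\<^sub>R ?R))"
    using Suc.IH Suc.prems by simp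
  finally show ?case
    by (simp add: matrix_mult_linear mult.commute)
qed simp

lemma can_simulate_of_op_prod:
  assumes K: "\<And>A. A \<in> K \<Longrightarrow> A ** A = mat 1"
    and S: "\<And>A. A \<in> K \<Longrightarrow> S ** A = A ** S"
    and Ks: "\<And>j. j \<in> {1..m} \<Longrightarrow> Ks j \<in> K"
    and prod: "S = op_prod Ks m \<or> S = - op_prod Ks m"
    and comm: "\<And>j. j \<in> {2..m} \<Longrightarrow> commutator (Ks j) (op_prod Ks (j - 1)) = 0"
  shows "can_simulate K S"
proof -
  \<comment> \<open>A fixed sequence suffices: outcome values and random bits are ignored, and after
    \<open>length \<gamma>\<close> steps the next operator is the one with the successor
    index.\<close>
  define f where "f = (\<lambda>(\<omega> :: bool list) (\<gamma> :: real list). Ks (Suc (length \<gamma>)))"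
  define e :: real where "e = (if S = op_prod Ks m then 1 else - 1)"
  define \<sigma> :: "real list \<Rightarrow> real" where "\<sigma> = (\<lambda>\<gamma>. e * (\<Prod>j=1..m. \<gamma> ! (j - 1)))"
  have S_eq: "S = e *\<^sub>R op_prod Ks m"
    using prod by (auto simp: e_def)
  have sign: "\<gamma> ! (j - 1) \<in> {1, - 1}" if "\<gamma> \<in> outcomes m" "j \<in> {1..m}" for \<gamma> j
    using that nth_mem[of "j - 1" \<gamma>] unfolding outcomes_def by fastforce
  have run: "run_op f \<omega> \<gamma> = op_prod (\<lambda>j. meas_proj (Ks j) (\<gamma> ! (j - 1))) m"
    if "\<gamma> \<in> outcomes m" for \<omega> \<gamma>
    using that unfolding run_op_def f_def by (auto simp: outcomes_def intro!: op_prod_cong)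
  have "\<sigma> \<gamma> \<in> {1, - 1}" if "\<gamma> \<in> outcomes m" for \<gamma>
  proof -
    \<comment> \<open>A real number of absolute value 1 is a sign.\<close>
    have "\<bar>\<Prod>j=1..m. \<gamma> ! (j - 1)\<bar> = (\<Prod>j=1..m. 1)"
      unfolding abs_prod by (rule prod.cong) (use sign[OF that] in fastforce)+
    then show ?thesis
      by (auto simp: \<sigma>_def e_def abs_if split: if_splits)
  qed
  moreover have "S ** run_op f \<omega> \<gamma> = run_op f \<omega> \<gamma> ** S" if "\<gamma> \<in> outcomes m" for \<omega> \<gamma>
    unfolding run[OF that]
    by (rule op_prod_commute) (metis S Ks meas_proj_commute)
  moreover have "S ** run_op f \<omega> \<gamma> = \<sigma> \<gamma> *\<^sub>R run_op f \<omega> \<gamma>" if "\<gamma> \<in> outcomes m" for \<omega> \<gamma>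
    using op_prod_meas_proj[of m Ks "\<lambda>j. \<gamma> ! (j - 1)"] K Ks sign[OF that] comm
    by (simp add: run[OF that] S_eq \<sigma>_def matrix_mult_linear commutator_def)
  ultimately have "simulates m 0 f S"
    unfolding simulates_def by (intro exI[of _ \<sigma>]) auto
  moreover have "adaptive_protocol K m 0 f"
    using Ks by (auto simp: adaptive_protocol_def f_def outcomes_def)
  ultimately show ?thesis
    unfolding can_simulate_def by blast
qed

section \<open>From a simulating protocol to a product\<close>

lemma can_simulate_imp_commuting_product:
  assumes K: "K \<subseteq> carrier pauli_group" and herm: "\<And>A. A \<in> K \<Longrightarrow> dagger A = A"
    and S: "S \<in> carrier pauli_group" "dagger S = S"
    and "can_simulate K S"
  obtains P where "P \<in> commuting_products K" "S = P \<or> S = - P"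
proof -
  obtain m r f where f: "adaptive_protocol K m r f" "simulates m r f S"
    using assms(5) unfolding can_simulate_def by blast
  \<comment> \<open>Simulation holds for all values of the random bits, so any fixed choice will
    do.\<close>
  define \<omega> where "\<omega> = replicate r True"
  obtain \<gamma> where \<gamma>: "\<gamma> \<in> outcomes m" "run_op f \<omega> \<gamma> \<noteq> 0"
    using exists_nonzero_run by blast
  let ?Q = "run_op f \<omega> \<gamma> ** dagger (run_op f \<omega> \<gamma>)"
  have "length \<omega> = r" by (simp add: \<omega>_def)
  with f(2) \<gamma>(1) obtain s :: real where s: "s \<in> {1, - 1}" "S ** run_op f \<omega> \<gamma> = s *\<^sub>R run_op f \<omega> \<gamma>"
    unfolding simulates_def by metis
  have span: "?Q \<in> span (commuting_products K)"
    using run_op_dagger_in_span[OF K herm, of m f \<omega> m \<gamma>] f(1) \<open>length \<omega> = r\<close> \<gamma>(1)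
    by (auto simp: adaptive_protocol_def)
  have "trace (S ** ?Q) = s *\<^sub>R trace ?Q"
    by (simp add: matrix_mul_assoc s(2) matrix_mult_linear) (simp add: trace_def scaleR_sum_right)
  then have nz: "trace (S ** ?Q) \<noteq> 0"
    using s(1) trace_mult_dagger_nonzero[OF \<gamma>(2)] by auto
  have "linear (\<lambda>A. trace (S ** A))"
    by (rule linearI)
      (simp_all add: matrix_mult_linear trace_add, simp add: trace_def scaleR_sum_right)
  \<comment> \<open>A linear functional vanishing on all the products would vanish on their span,
    which contains \<open>?Q\<close>.\<close>
  then obtain P where P: "P \<in> commuting_products K" "trace (S ** P) \<noteq> 0"
    using linear_eq_0_on_span[of "\<lambda>A. trace (S ** A)" "commuting_products K" ?Q] span nz by blast
  obtain k where k: "S ** P = mat k"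
    using pauli_trace_nonzero_imp_scalar P(2)
      pauli_mult_closed[OF S(1) commuting_products_pauli[OF K P(1)]] by metis
  have "P ** P = mat 1"
    using commuting_products_involution[OF _ P(1)] pauli_hermitian_involution K herm by blast
  then have S_eq: "S = mat k ** P"
    by (metis k matrix_mul_assoc matrix_mul_rid)
  have "S ** S = mat 1"
    using S by (rule pauli_hermitian_involution)
  \<comment> \<open>Both \<open>S\<close> and \<open>P\<close> square to the identity, so comparing
    squares in \<open>S = mat k ** P\<close> forces \<open>k * k = 1\<close>.\<close>
  then have "(mat 1 :: 'a qop) = mat k ** (P ** mat k) ** P"
    by (simp add: S_eq matrix_mul_assoc)
  also have "\<dots> = mat k ** mat k ** (P ** P)"
    by (simp only: mat_mult_commute[of k P, symmetric] matrix_mul_assoc)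
  also have "\<dots> = mat k ** mat k"
    by (simp add: \<open>P ** P = mat 1\<close>)
  finally have "(mat 1 :: 'a qop) $ b $ b = (mat k ** (mat k :: 'a qop)) $ b $ b" for b
    by simp
  then have "k * k = 1"
    by (simp add: mat_mult_nth) (simp add: mat_def)
  then have "k = 1 \<or> k = - 1"
    by (simp add: square_eq_1_iff)
  then have "S = P \<or> S = - P"
    using S_eq by (auto simp: mat_minus matrix_mult_linear)
  with P(1) show ?thesis by (rule that)
qed

theorem mainTheorem1:
  fixes G K :: "'n::finite qop set" and S :: "'n qop"
  assumes "subgroup G pauli_group"
    and "finite K" and "K \<subseteq> G"
    and "\<forall>A\<in>K. dagger A = A"
    and "generate pauli_group (insert (mat \<i>) G) = generate pauli_group (insert (mat \<i>) K)"
    and "S \<in> generate pauli_group (insert (mat \<i>) G) \<inter> pauli_centralizer G"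
    and "dagger S = S"
  shows "can_simulate K S \<longleftrightarrow>
    (\<exists>(m::nat) (Ks :: nat \<Rightarrow> 'n qop).
       (\<forall>j\<in>{1..m}. Ks j \<in> K) \<and>
       (S = op_prod Ks m \<or> S = - op_prod Ks m) \<and>
       (\<forall>j\<in>{2..m}. commutator (Ks j) (op_prod Ks (j - 1)) = 0))"
proof
  have K: "K \<subseteq> carrier pauli_group"
    using assms(1,3) subgroup.subset by blast
  \<comment> \<open>Commuting with \<open>G\<close> gives commuting with each measured operator,
    because \<open>K \<subseteq> G\<close>.\<close>
  have S: "S \<in> carrier pauli_group" "\<And>A. A \<in> K \<Longrightarrow> S ** A = A ** S"
    using assms(3,6) by (auto simp: pauli_centralizer_def)
  {
    assume "can_simulate K S"
    then obtain P where P: "P \<in> commuting_products K" "S = P \<or> S = - P"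
      using can_simulate_imp_commuting_product K S(1) assms(4,7) by blast
    from P(2) commuting_products_imp_op_prod[OF P(1)]
    show "\<exists>(m::nat) (Ks :: nat \<Rightarrow> 'n qop).
       (\<forall>j\<in>{1..m}. Ks j \<in> K) \<and>
       (S = op_prod Ks m \<or> S = - op_prod Ks m) \<and>
       (\<forall>j\<in>{2..m}. commutator (Ks j) (op_prod Ks (j - 1)) = 0)"
      by blast
  }
  assume "\<exists>(m::nat) (Ks :: nat \<Rightarrow> 'n qop).
       (\<forall>j\<in>{1..m}. Ks j \<in> K) \<and>
       (S = op_prod Ks m \<or> S = - op_prod Ks m) \<and>
       (\<forall>j\<in>{2..m}. commutator (Ks j) (op_prod Ks (j - 1)) = 0)"
  moreover have "A ** A = mat 1" if "A \<in> K" for A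
    using that K assms(4) pauli_hermitian_involution by blast
  ultimately show "can_simulate K S"
    using can_simulate_of_op_prod[of K S] S(2) by blast
qed

end
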